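(* Let $p\in[1,\infty)$ and assume that $G$ is a graph with bounded degree and compression exponent $\alpha$ in some $L^p$ space. Then there is a constant $K=K(p)$ such that for every integer $n\geq 2$, $$\Pi_{G,p}(n)\leq K\frac{n}{(\log n)^{\alpha}}.$$
   Context: Graphs are unoriented, without loops; $V\Gamma$ is the vertex set of $\Gamma$, equipped with the shortest path metric, and $B(g,1)$ is the closed ball of radius $1$ around $g$. For a finite graph $\Gamma$ and $p\in[1,\infty)$, the $L^p$-Cheeger constant is $h_p(\Gamma)=\inf\left\{\frac{\|\nabla f\|_p}{\|f-f_\Gamma\|_p} : f\colon V\Gamma\to\mathbb{R} \text{ non-constant}\right\}$, where $|\nabla f|(g)=\sup_{h,h'\in B(g,1)}|f(h)-f(h')|$, $f_\Gamma=|V\Gamma|^{-1}\sum_{g\in V\Gamma}f(g)$, and norms are $\ell^p(V\Gamma)$-norms; by convention $h_p(\Gamma)=0$ if $\Gamma$ has one vertex. The $L^p$-Poincaré profile of an (infinite) graph $G$ is $\Pi_{G,p}(n)=\sup\{|V\Gamma|\,h_p(\Gamma): \Gamma\subset G \text{ a finite subgraph},\ |V\Gamma|\leq n\}$. The compression function of a $1$-Lipschitz map $F\colon VG\to L^p$ is $\rho_F(t)=\inf\{\|F(g)-F(h)\|_p : d_G(g,h)\geq t\}$. The graph $G$ has compression exponent $\alpha\geq 0$ in $L^p$ if there exists a $1$-Lipschitz map $F\colon VG\to L^p$ such that $\rho_F(t)\succeq t^\alpha$, i.e. there is $c>0$ with $\rho_F(t)\geq c\,t^\alpha$ for all large enough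 $t$. The constant $K$ may depend on $G$, $F$ and $p$, but not on $n$. *)

theory Defs
  imports "HOL-Analysis.Analysis" "Graph_Theory.Graph_Theory"
begin

text \<open>
  As in Graph_Theory, an unoriented graph is a symmetric digraph.  Graphs may be infinite and
  disconnected; nothing below depends on the multiplicity of edges.
\<close>

definition unoriented_graph :: "('a, 'e) pre_digraph \<Rightarrow> bool" where
  "unoriented_graph G \<longleftrightarrow> sym_digraph G \<and> loopfree_digraph G"

text \<open>The finiteness clause is needed because \<^const>\<open>card\<close> vanishes on infinite sets.\<close>

definition bounded_degree :: "('a, 'e) pre_digraph \<Rightarrow> bool" where
  "bounded_degree G \<longleftrightarrow>
    (\<exists>D. \<forall>v \<in> verts G. finite (out_arcs G v) \<and> out_degree G v \<le> D)"

text \<open>The distance between different connected components is \<open>\<infinity>\<close>.\<close>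

definition graph_dist :: "('a, 'e) pre_digraph \<Rightarrow> 'a \<Rightarrow> 'a \<Rightarrow> ereal" where
  "graph_dist G u v = wf_digraph.\<mu> G (\<lambda>_. 1) u v"

definition unit_ball :: "('a, 'e) pre_digraph \<Rightarrow> 'a \<Rightarrow> 'a set" where
  "unit_ball G g = {h \<in> verts G. graph_dist G g h \<le> 1}"


subsection \<open>Cheeger constants and Poincare profiles\<close>

definition lp_norm_on :: "'a set \<Rightarrow> real \<Rightarrow> ('a \<Rightarrow> real) \<Rightarrow> real" where
  "lp_norm_on V p f = (\<Sum>v\<in>V. \<bar>f v\<bar> powr p) powr (1 / p)"

definition abs_gradient :: "('a, 'e) pre_digraph \<Rightarrow> ('a \<Rightarrow> real) \<Rightarrow> 'a \<Rightarrow> real" where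
  "abs_gradient G f g =
    (SUP (h, h') \<in> unit_ball G g \<times> unit_ball G g. \<bar>f h - f h'\<bar>)"

definition vertex_average :: "('a, 'e) pre_digraph \<Rightarrow> ('a \<Rightarrow> real) \<Rightarrow> real" where
  "vertex_average G f = (\<Sum>g\<in>verts G. f g) / real (card (verts G))"

text \<open>
  Functions on the vertex set are represented by functions on the whole type; only their values on
  \<^term>\<open>verts G\<close> enter.
\<close>

definition cheeger_constant :: "('a, 'e) pre_digraph \<Rightarrow> real \<Rightarrow> real" where
  "cheeger_constant G p =
    (if card (verts G) = 1 then 0
     else Inf {lp_norm_on (verts G) p (abs_gradient G f) /
               lp_norm_on (verts G) p (\<lambda>g. f g - vertex_average G f)
               | f :: 'a \<Rightarrow> real. \<not> f constant_on verts G})"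

text \<open>
  \<^const>\<open>pseudo_graph\<close> says finite and symmetric; looplessness is inherited from \<open>G\<close>.
  The supremum is taken in \<^typ>\<open>ereal\<close>, so that it is meaningful without a boundedness argument.
\<close>

definition poincare_profile :: "('a, 'e) pre_digraph \<Rightarrow> real \<Rightarrow> nat \<Rightarrow> ereal" where
  "poincare_profile G p n =
    Sup {ereal (real (card (verts H)) * cheeger_constant H p)
         | H. subgraph H G \<and> pseudo_graph H \<and> verts H \<noteq> {} \<and> card (verts H) \<le> n}"


subsection \<open>Compression of maps into L^p spaces\<close>

text \<open>
  An element of L^p is represented by a function rather than by its class modulo null sets; only
  the seminorm of differences is used below.
\<close>

definition Lp_space :: "'m measure \<Rightarrow> real \<Rightarrow> ('m \<Rightarrow> real) set" where
  "Lp_space M p = {u \<in> borel_measurable M. integrable M (\<lambda>x. \<bar>u x\<bar> powr p)}"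

definition Lp_norm :: "'m measure \<Rightarrow> real \<Rightarrow> ('m \<Rightarrow> real) \<Rightarrow> real" where
  "Lp_norm M p u = (\<integral>x. \<bar>u x\<bar> powr p \<partial>M) powr (1 / p)"

definition one_Lipschitz_Lp ::
    "('a, 'e) pre_digraph \<Rightarrow> 'm measure \<Rightarrow> real \<Rightarrow> ('a \<Rightarrow> 'm \<Rightarrow> real) \<Rightarrow> bool" where
  "one_Lipschitz_Lp G M p F \<longleftrightarrow>
    F \<in> verts G \<rightarrow> Lp_space M p \<and>
    (\<forall>g \<in> verts G. \<forall>h \<in> verts G.
       ereal (Lp_norm M p (\<lambda>x. F g x - F h x)) \<le> graph_dist G g h)"

text \<open>In \<^typ>\<open>ereal\<close> the infimum of the empty set is \<open>\<infinity>\<close>.\<close>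

definition compression_function ::
    "('a, 'e) pre_digraph \<Rightarrow> 'm measure \<Rightarrow> real \<Rightarrow> ('a \<Rightarrow> 'm \<Rightarrow> real) \<Rightarrow> real \<Rightarrow> ereal" where
  "compression_function G M p F t =
    Inf {ereal (Lp_norm M p (\<lambda>x. F g x - F h x))
         | g h. g \<in> verts G \<and> h \<in> verts G \<and> ereal t \<le> graph_dist G g h}"

definition has_compression_exponent ::
    "('a, 'e) pre_digraph \<Rightarrow> 'm measure \<Rightarrow> real \<Rightarrow> real \<Rightarrow> bool" where
  "has_compression_exponent G M p \<alpha> \<longleftrightarrow> 0 \<le> \<alpha> \<and>
    (\<exists>F. one_Lipschitz_Lp G M p F \<and>
      (\<exists>c>0. \<forall>\<^sub>F t in at_top. ereal (c * t powr \<alpha>) \<le> compression_function G M p F t))"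

end

theory Submission
  imports Defs
begin

text \<open>
  Let \<open>\<Gamma>\<close> be a finite subgraph of \<open>G\<close> with \<open>N\<close> vertices, and \<open>F\<close> a \<open>1\<close>-Lipschitz map from \<open>G\<close>
  to \<open>L\<^sup>p\<close> that realises the compression exponent. Every point \<open>x\<close> of the measure space gives a
  real function \<open>g \<mapsto> F g x\<close> on \<open>\<Gamma>\<close>, to which the inequality that defines \<open>h\<^sub>p(\<Gamma>)\<close> applies. Once
  it is raised to the power \<open>p\<close> and the average and the gradient are estimated by differences of
  values, it compares finite sums, over all pairs of vertices on one side and over pairs at
  distance at most \<open>1\<close> on the other; so it can be integrated over \<open>x\<close>, and
  \<open>h\<^sub>p(\<Gamma>)\<^sup>p\<close> times the sum of \<open>\<parallel>F g - F h\<parallel>\<^sup>p\<close> over all pairs is at most a constant times \<open>N\<close> times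
  the sum over the short pairs (\<open>poincare_inequality_Lp_map\<close>). Since \<open>F\<close> is \<open>1\<close>-Lipschitz and the
  degree is bounded, the right-hand side is at most a constant times \<open>N\<^sup>2\<close>.

  On the other hand balls in \<open>G\<close> grow at most exponentially (\<open>card_graph_dist_less_le\<close>). Hence, for
  \<open>t\<close> a small multiple of \<open>ln N\<close>, at least half of the \<open>N\<^sup>2\<close> pairs are at distance at least \<open>t\<close>
  in \<open>G\<close>, and \<open>F\<close> separates these by at least a constant times \<open>t\<^sup>\<alpha>\<close>. Comparing the two estimates
  gives \<open>h\<^sub>p(\<Gamma>) \<le> C / (ln N)\<^sup>\<alpha>\<close> for large \<open>N\<close>. For small \<open>N\<close> a crude bound on the Cheeger constant
  suffices (\<open>cheeger_constant_le_two_card\<close>). The estimate of the profile follows because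
  \<open>N / (ln N)\<^sup>\<alpha>\<close> is, up to a constant factor, increasing in \<open>N\<close> (\<open>powr_div_ln_quasi_mono\<close>).
\<close>

section \<open>Distances and growth of balls\<close>

lemma exists_walk_of_graph_dist_less:
  assumes "wf_digraph G" and "graph_dist G u v < ereal t"
  shows "\<exists>w. pre_digraph.awalk G u w v \<and> real (length w) < t"
proof -
  interpret wf_digraph G by fact
  have "awalk_cost (\<lambda>_. 1) w = real (length w)" for w
    by (induction w) auto
  then show ?thesis
    using assms(2) unfolding graph_dist_def \<mu>_def INF_less_iff by auto
qed

text \<open>
  A walk of length at most \<open>k + 1\<close> is empty or starts with one of at most \<open>D\<close> arcs, so the balls
  satisfy \<open>b\<^bsub>k+1\<^esub> \<le> 1 + D b\<^sub>k\<close>. The base \<open>D + 2\<close>, rather than \<open>D + 1\<close>, is larger than \<open>1\<close> even for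
  \<open>D = 0\<close>, so that its logarithm can later serve as a denominator.
\<close>

lemma card_walk_ball_le:
  assumes "wf_digraph G"
    and deg: "\<And>v. v \<in> verts G \<Longrightarrow> finite (out_arcs G v) \<and> out_degree G v \<le> D"
    and "u \<in> verts G"
  shows "finite {v. \<exists>w. pre_digraph.awalk G u w v \<and> length w \<le> k} \<and>
    card {v. \<exists>w. pre_digraph.awalk G u w v \<and> length w \<le> k} \<le> (D + 2) ^ k"
  using \<open>u \<in> verts G\<close>
proof (induction k arbitrary: u)
  interpret wf_digraph G by fact
  case 0
  have "{v. \<exists>w. awalk u w v \<and> length w \<le> 0} = {u}"
    using 0 by (auto simp: awalk_Nil_iff)
  then show ?case by simp
next
  interpret wf_digraph G by fact
  case (Suc k)
  define B where "B x = {v. \<exists>w. awalk x w v \<and> length w \<le> k}" for x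
  have IH: "finite (B x)" "card (B x) \<le> (D + 2) ^ k" if "x \<in> verts G" for x
    using Suc.IH[OF that] by (auto simp: B_def)
  have sub: "{v. \<exists>w. awalk u w v \<and> length w \<le> Suc k}
      \<subseteq> insert u (\<Union>e\<in>out_arcs G u. B (head G e))"
  proof
    fix v assume "v \<in> {v. \<exists>w. awalk u w v \<and> length w \<le> Suc k}"
    then obtain w where "awalk u w v" "length w \<le> Suc k" by auto
    then show "v \<in> insert u (\<Union>e\<in>out_arcs G u. B (head G e))"
      by (cases w) (auto simp: awalk_simps B_def)
  qed
  have fin: "finite (\<Union>e\<in>out_arcs G u. B (head G e))"
    using deg[OF Suc.prems] IH by auto
  have "card (\<Union>e\<in>out_arcs G u. B (head G e)) \<le> (\<Sum>e\<in>out_arcs G u. card (B (head G e)))"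
    using deg[OF Suc.prems] by (intro card_UN_le) auto
  also have "\<dots> \<le> (\<Sum>e\<in>out_arcs G u. (D + 2) ^ k)"
    by (intro sum_mono IH) auto
  also have "\<dots> \<le> D * (D + 2) ^ k"
    using deg[OF Suc.prems] by (simp add: out_degree_def)
  finally have "card (insert u (\<Union>e\<in>out_arcs G u. B (head G e))) \<le> Suc (D * (D + 2) ^ k)"
    using fin by (simp add: card_insert_if)
  also have "\<dots> \<le> D * (D + 2) ^ k + 2 * (D + 2) ^ k"
    using one_le_power[of "D + 2" k] by linarith
  also have "\<dots> = (D + 2) ^ Suc k"
    by (simp only: power_Suc add_mult_distrib)
  finally have "card (insert u (\<Union>e\<in>out_arcs G u. B (head G e))) \<le> (D + 2) ^ Suc k" .
  moreover have "finite (insert u (\<Union>e\<in>out_arcs G u. B (head G e)))"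
    using fin by simp
  ultimately show ?case
    using card_mono[OF _ sub] finite_subset[OF sub] by (meson order_trans)
qed

lemma card_graph_dist_less_le:
  assumes "wf_digraph G"
    and deg: "\<And>v. v \<in> verts G \<Longrightarrow> finite (out_arcs G v) \<and> out_degree G v \<le> D"
    and "u \<in> verts G" and "0 \<le> t"
  shows "finite {v. graph_dist G u v < ereal t} \<and>
    real (card {v. graph_dist G u v < ereal t}) \<le> real (D + 2) powr t"
proof -
  define k where "k = nat \<lfloor>t\<rfloor>"
  let ?B = "{v. \<exists>w. pre_digraph.awalk G u w v \<and> length w \<le> k}"
  have sub: "{v. graph_dist G u v < ereal t} \<subseteq> ?B"
  proof
    fix v assume "v \<in> {v. graph_dist G u v < ereal t}"
    then obtain w where w: "pre_digraph.awalk G u w v" "real (length w) < t"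
      using exists_walk_of_graph_dist_less[OF assms(1)] by blast
    then have "length w \<le> k" unfolding k_def by linarith
    with w show "v \<in> ?B" by auto
  qed
  have B: "finite ?B" "card ?B \<le> (D + 2) ^ k"
    using card_walk_ball_le[OF assms(1) deg assms(3)] by auto
  have "real (card {v. graph_dist G u v < ereal t}) \<le> real ((D + 2) ^ k)"
    using card_mono[OF B(1) sub] B(2) by linarith
  also have "\<dots> = real (D + 2) powr real k"
    by (simp add: powr_realpow)
  also have "\<dots> \<le> real (D + 2) powr t"
    using \<open>0 \<le> t\<close> by (intro powr_mono) (auto simp: k_def)
  finally show ?thesis
    using finite_subset[OF sub B(1)] by simp
qed

lemma self_in_unit_ball:
  assumes "wf_digraph H" and "g \<in> verts H"
  shows "g \<in> unit_ball H g"
proof -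
  interpret wf_digraph H by fact
  have "graph_dist H g g \<le> ereal (awalk_cost (\<lambda>_. 1) [])"
    unfolding graph_dist_def using assms(2)
    by (intro min_cost_le_walk_cost) (simp add: awalk_Nil_iff)
  also have "\<dots> \<le> 1" by simp
  finally show ?thesis using assms(2) by (simp add: unit_ball_def)
qed

text \<open>
  Passing to a subgraph removes walks and so can only increase distances. This is what makes the
  gradient on a subgraph controllable by the Lipschitz condition in the ambient graph.
\<close>

lemma unit_ball_subgraph:
  assumes "subgraph H G"
  shows "unit_ball H g \<subseteq> unit_ball G g"
proof -
  interpret G: wf_digraph G using assms by auto
  interpret H: wf_digraph H using assms by auto
  have walks: "{w. H.awalk g w h} \<subseteq> {w. G.awalk g w h}" for h
    using G.subgraph_awalk_imp_awalk[OF _ assms] by blast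
  have "graph_dist G g h \<le> graph_dist H g h" for h
    unfolding graph_dist_def G.\<mu>_def H.\<mu>_def
    by (rule INF_superset_mono[OF walks]) simp
  then show ?thesis
    using subgraph_imp_subverts[OF assms] by (auto simp: unit_ball_def intro: order_trans)
qed

section \<open>Poincare inequalities on finite graphs\<close>

lemma abs_add_powr_le:
  fixes a b :: real
  assumes "0 \<le> p"
  shows "\<bar>a + b\<bar> powr p \<le> 2 powr p * (\<bar>a\<bar> powr p + \<bar>b\<bar> powr p)"
proof -
  have "\<bar>a + b\<bar> powr p \<le> (2 * max \<bar>a\<bar> \<bar>b\<bar>) powr p"
    using assms by (intro powr_mono2) auto
  also have "\<dots> = 2 powr p * max \<bar>a\<bar> \<bar>b\<bar> powr p"
    by (simp add: powr_mult)
  also have "max \<bar>a\<bar> \<bar>b\<bar> powr p \<le> \<bar>a\<bar> powr p + \<bar>b\<bar> powr p"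
    by (auto simp: max_def)
  finally show ?thesis by simp
qed

lemma abs_gradient_attained:
  assumes "finite (unit_ball H g)" and "g \<in> unit_ball H g"
  obtains h h' where "h \<in> unit_ball H g" "h' \<in> unit_ball H g"
    "abs_gradient H f g = \<bar>f h - f h'\<bar>"
proof -
  let ?S = "(\<lambda>(h, h'). \<bar>f h - f h'\<bar>) ` (unit_ball H g \<times> unit_ball H g)"
  have "finite ?S" "?S \<noteq> {}" using assms by auto
  then have "Sup ?S \<in> ?S" by (metis Max_in cSup_eq_Max)
  then show ?thesis using that unfolding abs_gradient_def by auto
qed

text \<open>
  The supremum is attained by a pair of vertices in the ball; passing through the centre replaces
  it by two differences with the centre, whose \<open>p\<close>-th powers are summands on the right. The sum,
  unlike the supremum, commutes with integration.
\<close>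

lemma abs_gradient_powr_le:
  assumes "0 \<le> p" and "finite (unit_ball H g)" and "g \<in> unit_ball H g"
  shows "\<bar>abs_gradient H f g\<bar> powr p
    \<le> 2 * 2 powr p * (\<Sum>h\<in>unit_ball H g. \<bar>f h - f g\<bar> powr p)"
proof -
  obtain h h' where h: "h \<in> unit_ball H g" "h' \<in> unit_ball H g"
    and eq: "abs_gradient H f g = \<bar>f h - f h'\<bar>"
    using abs_gradient_attained[OF assms(2,3)] .
  have *: "\<bar>f x - f g\<bar> powr p \<le> (\<Sum>h\<in>unit_ball H g. \<bar>f h - f g\<bar> powr p)"
    if "x \<in> unit_ball H g" for x
    using that assms(2) by (intro member_le_sum) auto
  have "\<bar>abs_gradient H f g\<bar> powr p = \<bar>(f h - f g) + (f g - f h')\<bar> powr p"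
    by (simp add: eq)
  also have "\<dots> \<le> 2 powr p * (\<bar>f h - f g\<bar> powr p + \<bar>f g - f h'\<bar> powr p)"
    by (rule abs_add_powr_le[OF assms(1)])
  also have "\<dots> = 2 powr p * (\<bar>f h - f g\<bar> powr p + \<bar>f h' - f g\<bar> powr p)"
    by (simp add: abs_minus_commute)
  also have "\<dots> \<le> 2 powr p * ((\<Sum>h\<in>unit_ball H g. \<bar>f h - f g\<bar> powr p)
      + (\<Sum>h\<in>unit_ball H g. \<bar>f h - f g\<bar> powr p))"
    using *[OF h(1)] *[OF h(2)] by (intro mult_left_mono) auto
  finally show ?thesis by simp
qed

lemma lp_norm_on_nonneg: "0 \<le> lp_norm_on V p f"
  by (simp add: lp_norm_on_def)

lemma lp_norm_on_powr:
  assumes "p \<noteq> 0"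
  shows "lp_norm_on V p f powr p = (\<Sum>v\<in>V. \<bar>f v\<bar> powr p)"
  using assms by (simp add: lp_norm_on_def powr_powr sum_nonneg)

lemma cheeger_constant_le_ratio:
  assumes "card (verts H) \<noteq> 1" and "\<not> f constant_on verts H"
  shows "cheeger_constant H p \<le> lp_norm_on (verts H) p (abs_gradient H f) /
               lp_norm_on (verts H) p (\<lambda>g. f g - vertex_average H f)"
proof -
  have "cheeger_constant H p = Inf {lp_norm_on (verts H) p (abs_gradient H f) /
               lp_norm_on (verts H) p (\<lambda>g. f g - vertex_average H f)
               | f. \<not> f constant_on verts H}"
    using assms(1) by (simp add: cheeger_constant_def)
  also have "\<dots> \<le> lp_norm_on (verts H) p (abs_gradient H f) /
               lp_norm_on (verts H) p (\<lambda>g. f g - vertex_average H f)"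
    using assms(2)
    by (intro cInf_lower) (auto intro!: bdd_belowI[of _ 0] divide_nonneg_nonneg lp_norm_on_nonneg)
  finally show ?thesis .
qed

lemma indicator_not_constant_on:
  assumes "2 \<le> card V" and "v \<in> V"
  shows "\<not> (\<lambda>u. if u = v then 1 else 0 :: real) constant_on V"
proof
  assume "(\<lambda>u. if u = v then 1 else 0 :: real) constant_on V"
  then obtain y where y: "(if u = v then 1 else 0 :: real) = y" if "u \<in> V" for u
    by (auto simp: constant_on_def)
  then have "u = v" if "u \<in> V" for u
    using y[OF assms(2)] y[OF that] by (auto split: if_splits)
  then have "V \<subseteq> {v}" by auto
  then have "card V \<le> card {v}" by (intro card_mono) auto
  then show False using assms(1) by simp
qed

lemma cheeger_constant_nonneg:
  assumes "2 \<le> card (verts H)"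
  shows "0 \<le> cheeger_constant H p"
proof -
  have "verts H \<noteq> {}" using assms by auto
  then obtain v where "v \<in> verts H" by blast
  then have "\<not> (\<lambda>u. if u = v then 1 else 0 :: real) constant_on verts H"
    using assms by (intro indicator_not_constant_on)
  then show ?thesis
    using assms unfolding cheeger_constant_def
    by (auto intro!: cInf_greatest divide_nonneg_nonneg lp_norm_on_nonneg)
qed

text \<open>
  The definition of the Cheeger constant, multiplied out and raised to the power \<open>p\<close>. In this form
  it also holds for constant functions, which is needed because a single coordinate of a
  vector-valued map may be constant.
\<close>

lemma poincare_inequality:
  assumes "0 < p" and "finite (verts H)" and "2 \<le> card (verts H)"
  shows "cheeger_constant H p powr p *
      (\<Sum>g\<in>verts H. \<bar>f g - vertex_average H f\<bar> powr p)
    \<le> (\<Sum>g\<in>verts H. \<bar>abs_gradient H f g\<bar> powr p)"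
proof (cases "f constant_on verts H")
  case True
  then obtain c where c: "\<And>g. g \<in> verts H \<Longrightarrow> f g = c" by (auto simp: constant_on_def)
  then have "vertex_average H f = c"
    using assms by (auto simp: vertex_average_def)
  then have "(\<Sum>g\<in>verts H. \<bar>f g - vertex_average H f\<bar> powr p) = 0"
    using c by simp
  then show ?thesis by (simp add: sum_nonneg)
next
  case False
  define S where "S = lp_norm_on (verts H) p (\<lambda>g. f g - vertex_average H f)"
  have "S powr p \<noteq> 0"
  proof
    assume "S powr p = 0"
    then have "\<forall>g\<in>verts H. f g = vertex_average H f"
      using assms by (simp add: S_def lp_norm_on_powr sum_nonneg_eq_0_iff)
    with False show False by (auto simp: constant_on_def)
  qed
  then have "0 < S" using lp_norm_on_nonneg[of "verts H" p] by (auto simp: S_def less_le)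
  moreover have "cheeger_constant H p \<le> lp_norm_on (verts H) p (abs_gradient H f) / S"
    unfolding S_def using assms False by (intro cheeger_constant_le_ratio) auto
  ultimately have "cheeger_constant H p * S \<le> lp_norm_on (verts H) p (abs_gradient H f)"
    by (simp add: field_simps)
  then have "(cheeger_constant H p * S) powr p \<le> lp_norm_on (verts H) p (abs_gradient H f) powr p"
    using assms cheeger_constant_nonneg[OF assms(3)] \<open>0 < S\<close> by (intro powr_mono2) auto
  then show ?thesis
    using assms cheeger_constant_nonneg[OF assms(3)] \<open>0 < S\<close>
    by (simp add: powr_mult lp_norm_on_powr S_def)
qed

text \<open>
  The average is eliminated: differences \<open>f g - f h\<close> pass through the average on the left, and the
  gradient is replaced by a sum on the right. Both sides are then finite sums of terms
  \<open>\<bar>f g - f h\<bar>\<^sup>p\<close>, whose integrals are powers of \<open>L\<^sup>p\<close> norms.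
\<close>

lemma poincare_inequality_pairs:
  assumes "0 < p" and "wf_digraph H" and fin: "finite (verts H)" and "2 \<le> card (verts H)"
  shows "cheeger_constant H p powr p * (\<Sum>g\<in>verts H. \<Sum>h\<in>verts H. \<bar>f g - f h\<bar> powr p)
    \<le> 4 * 4 powr p * real (card (verts H)) *
        (\<Sum>g\<in>verts H. \<Sum>h\<in>unit_ball H g. \<bar>f h - f g\<bar> powr p)"
proof -
  define m where "m = vertex_average H f"
  define c where "c = cheeger_constant H p powr p"
  define A where "A = (\<Sum>g\<in>verts H. \<bar>f g - m\<bar> powr p)"
  define N where "N = real (card (verts H))"
  have "c \<ge> 0" "N \<ge> 0" by (simp_all add: c_def N_def)
  have "(\<Sum>g\<in>verts H. \<Sum>h\<in>verts H. \<bar>f g - f h\<bar> powr p)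
      \<le> (\<Sum>g\<in>verts H. \<Sum>h\<in>verts H. 2 powr p * (\<bar>f g - m\<bar> powr p + \<bar>f h - m\<bar> powr p))"
  proof (intro sum_mono)
    fix g h
    show "\<bar>f g - f h\<bar> powr p \<le> 2 powr p * (\<bar>f g - m\<bar> powr p + \<bar>f h - m\<bar> powr p)"
      using abs_add_powr_le[of p "f g - m" "m - f h"] \<open>0 < p\<close> by (simp add: abs_minus_commute)
  qed
  also have "\<dots> = 2 powr p * (2 * N * A)"
    by (simp add: sum_distrib_left[symmetric] sum.distrib A_def N_def)
  finally have "c * (\<Sum>g\<in>verts H. \<Sum>h\<in>verts H. \<bar>f g - f h\<bar> powr p) \<le> c * (2 powr p * (2 * N * A))"
    using \<open>c \<ge> 0\<close> by (rule mult_left_mono)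
  also have "\<dots> = 2 powr p * (2 * N) * (c * A)" by simp
  also have "c * A \<le> (\<Sum>g\<in>verts H. \<bar>abs_gradient H f g\<bar> powr p)"
    unfolding c_def A_def m_def using assms by (intro poincare_inequality)
  also have "\<dots> \<le> (\<Sum>g\<in>verts H. 2 * 2 powr p * (\<Sum>h\<in>unit_ball H g. \<bar>f h - f g\<bar> powr p))"
    using assms by (intro sum_mono abs_gradient_powr_le self_in_unit_ball) (auto simp: unit_ball_def)
  also have "2 powr p * (2 * N) * \<dots> = 4 * (2 powr p * 2 powr p) * N *
      (\<Sum>g\<in>verts H. \<Sum>h\<in>unit_ball H g. \<bar>f h - f g\<bar> powr p)"
    by (simp add: sum_distrib_left[symmetric])
  also have "2 powr p * 2 powr p = (4::real) powr p"
    by (simp add: powr_mult[symmetric])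
  finally show ?thesis using \<open>N \<ge> 0\<close> by (simp add: c_def N_def mult_left_mono)
qed

text \<open>
  Tested on the indicator function of a vertex: its gradient is at most \<open>1\<close> everywhere, and its
  value at that vertex differs from the average \<open>1 / N\<close> by at least \<open>1 / 2\<close>.
\<close>

lemma cheeger_constant_le_two_card:
  assumes "1 \<le> p" and "wf_digraph H" and fin: "finite (verts H)" and card2: "2 \<le> card (verts H)"
  shows "cheeger_constant H p \<le> 2 * real (card (verts H))"
proof -
  obtain v where v: "v \<in> verts H" using card2 by fastforce
  define f :: "'a \<Rightarrow> real" where "f = (\<lambda>u. if u = v then 1 else 0)"
  define N where "N = real (card (verts H))"
  have "N \<ge> 2" using card2 by (simp add: N_def)
  have m: "vertex_average H f = 1 / N"
    using fin v by (simp add: vertex_average_def f_def N_def)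
  have fv: "f v = 1" by (simp add: f_def)
  have grad: "\<bar>abs_gradient H f g\<bar> powr p \<le> 1" if g: "g \<in> verts H" for g
  proof -
    have "finite (unit_ball H g)" using fin by (simp add: unit_ball_def)
    then obtain h h' where "abs_gradient H f g = \<bar>f h - f h'\<bar>"
      by (rule abs_gradient_attained[OF _ self_in_unit_ball[OF assms(2) g]])
    then show ?thesis using assms(1) by (auto simp: f_def)
  qed
  have "lp_norm_on (verts H) p (abs_gradient H f) \<le> N powr (1 / p)"
    unfolding lp_norm_on_def using assms sum_mono[OF grad]
    by (intro powr_mono2) (auto simp: N_def sum_nonneg)
  also have "\<dots> \<le> N powr 1"
    using assms \<open>N \<ge> 2\<close> by (intro powr_mono) auto
  finally have up: "lp_norm_on (verts H) p (abs_gradient H f) \<le> N"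
    using \<open>N \<ge> 2\<close> by simp
  have "1 / 2 = ((1 / 2) powr p) powr (1 / p)"
    using assms by (simp add: powr_powr)
  also have "\<dots> \<le> lp_norm_on (verts H) p (\<lambda>g. f g - vertex_average H f)"
    unfolding lp_norm_on_def
  proof (intro powr_mono2)
    have "(1 / 2) powr p \<le> \<bar>f v - vertex_average H f\<bar> powr p"
      using assms \<open>N \<ge> 2\<close> fv by (intro powr_mono2) (auto simp: m field_simps)
    also have "\<dots> \<le> (\<Sum>g\<in>verts H. \<bar>f g - vertex_average H f\<bar> powr p)"
      by (rule member_le_sum[OF v _ fin]) auto
    finally show "(1 / 2) powr p \<le> (\<Sum>g\<in>verts H. \<bar>f g - vertex_average H f\<bar> powr p)" .
  qed (use assms in auto)
  finally have low: "1 / 2 \<le> lp_norm_on (verts H) p (\<lambda>g. f g - vertex_average H f)" .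
  have "cheeger_constant H p \<le> lp_norm_on (verts H) p (abs_gradient H f) /
      lp_norm_on (verts H) p (\<lambda>g. f g - vertex_average H f)"
    using card2 indicator_not_constant_on[OF card2 v]
    by (intro cheeger_constant_le_ratio) (auto simp: f_def)
  also have "\<dots> \<le> N / (1 / 2)"
    using up low \<open>N \<ge> 2\<close> by (intro frac_le) auto
  finally show ?thesis by (simp add: N_def)
qed

section \<open>Maps from finite graphs into \<open>L\<^sup>p\<close>\<close>

lemma integrable_Lp_diff:
  assumes "0 < p" and "u \<in> Lp_space M p" and "v \<in> Lp_space M p"
  shows "integrable M (\<lambda>x. \<bar>u x - v x\<bar> powr p)"
proof -
  have [measurable]: "u \<in> borel_measurable M" "v \<in> borel_measurable M"
    using assms by (auto simp: Lp_space_def)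
  have "integrable M (\<lambda>x. 2 powr p * (\<bar>u x\<bar> powr p + \<bar>v x\<bar> powr p))"
    using assms by (auto simp: Lp_space_def)
  then show ?thesis
  proof (rule Bochner_Integration.integrable_bound)
    show "AE x in M. norm (\<bar>u x - v x\<bar> powr p) \<le> norm (2 powr p * (\<bar>u x\<bar> powr p + \<bar>v x\<bar> powr p))"
      using abs_add_powr_le[of p "u _" "- v _"] \<open>0 < p\<close> by auto
  qed measurable
qed

lemma Lp_norm_nonneg: "0 \<le> Lp_norm M p u"
  by (simp add: Lp_norm_def)

lemma Lp_norm_powr:
  assumes "p \<noteq> 0"
  shows "Lp_norm M p u powr p = (\<integral>x. \<bar>u x\<bar> powr p \<partial>M)"
  using assms by (simp add: Lp_norm_def powr_powr)

text \<open>
  The inequality for pairs holds for every coordinate function \<open>g \<mapsto> F g x\<close> with the same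
  constants, so it may be integrated over \<open>x\<close>, summand by summand.
\<close>

lemma poincare_inequality_Lp_map:
  assumes "0 < p" and "wf_digraph H" and fin: "finite (verts H)" and "2 \<le> card (verts H)"
    and Lp: "\<And>g. g \<in> verts H \<Longrightarrow> F g \<in> Lp_space M p"
  shows "cheeger_constant H p powr p *
      (\<Sum>g\<in>verts H. \<Sum>h\<in>verts H. Lp_norm M p (\<lambda>x. F g x - F h x) powr p)
    \<le> 4 * 4 powr p * real (card (verts H)) *
        (\<Sum>g\<in>verts H. \<Sum>h\<in>unit_ball H g. Lp_norm M p (\<lambda>x. F h x - F g x) powr p)"
proof -
  have int: "integrable M (\<lambda>x. \<bar>F g x - F h x\<bar> powr p)" if "g \<in> verts H" "h \<in> verts H" for g h
    using that assms by (intro integrable_Lp_diff) auto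
  have ball: "h \<in> verts H" if "h \<in> unit_ball H g" for g h
    using that by (simp add: unit_ball_def)
  have int1: "integrable M (\<lambda>x. \<Sum>g\<in>verts H. \<Sum>h\<in>verts H. \<bar>F g x - F h x\<bar> powr p)"
    by (intro Bochner_Integration.integrable_sum int)
  have int2: "integrable M (\<lambda>x. \<Sum>g\<in>verts H. \<Sum>h\<in>unit_ball H g. \<bar>F h x - F g x\<bar> powr p)"
    by (intro Bochner_Integration.integrable_sum int) (auto dest: ball)
  have "(\<integral>x. cheeger_constant H p powr p *
        (\<Sum>g\<in>verts H. \<Sum>h\<in>verts H. \<bar>F g x - F h x\<bar> powr p) \<partial>M)
    \<le> (\<integral>x. 4 * 4 powr p * real (card (verts H)) *
        (\<Sum>g\<in>verts H. \<Sum>h\<in>unit_ball H g. \<bar>F h x - F g x\<bar> powr p) \<partial>M)"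
    using assms int1 int2 by (intro integral_mono poincare_inequality_pairs) auto
  also have "(\<integral>x. cheeger_constant H p powr p *
        (\<Sum>g\<in>verts H. \<Sum>h\<in>verts H. \<bar>F g x - F h x\<bar> powr p) \<partial>M)
      = cheeger_constant H p powr p *
        (\<Sum>g\<in>verts H. \<Sum>h\<in>verts H. Lp_norm M p (\<lambda>x. F g x - F h x) powr p)"
    using \<open>0 < p\<close> int by (simp add: Lp_norm_powr Bochner_Integration.integral_sum)
  also have "(\<integral>x. 4 * 4 powr p * real (card (verts H)) *
        (\<Sum>g\<in>verts H. \<Sum>h\<in>unit_ball H g. \<bar>F h x - F g x\<bar> powr p) \<partial>M)
      = 4 * 4 powr p * real (card (verts H)) *
        (\<Sum>g\<in>verts H. \<Sum>h\<in>unit_ball H g. Lp_norm M p (\<lambda>x. F h x - F g x) powr p)"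
    using \<open>0 < p\<close> int ball by (simp add: Lp_norm_powr Bochner_Integration.integral_sum)
  finally show ?thesis .
qed

text \<open>
  In the integrated inequality the far pairs contribute at least \<open>(N\<^sup>2 / 2) s\<^sup>p\<close> on the left, and
  the right-hand side is at most \<open>4 * 4\<^sup>p N\<^sup>2 b\<close>; the factor \<open>N\<^sup>2\<close> cancels.
\<close>

lemma cheeger_constant_times_spread_le:
  assumes "1 \<le> p" and "wf_digraph H" and fin: "finite (verts H)" and card2: "2 \<le> card (verts H)"
    and Lp: "\<And>g. g \<in> verts H \<Longrightarrow> F g \<in> Lp_space M p"
    and ball: "\<And>g. g \<in> verts H \<Longrightarrow> real (card (unit_ball H g)) \<le> b"
    and lip: "\<And>g h. g \<in> verts H \<Longrightarrow> h \<in> unit_ball H g \<Longrightarrow> Lp_norm M p (\<lambda>x. F h x - F g x) \<le> 1"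
    and "0 \<le> s"
    and spread: "\<And>g. g \<in> verts H \<Longrightarrow>
      real (card (verts H)) / 2 \<le> real (card {h \<in> verts H. s \<le> Lp_norm M p (\<lambda>x. F g x - F h x)})"
  shows "cheeger_constant H p * s \<le> 32 * b"
proof -
  define N where "N = real (card (verts H))"
  define c where "c = cheeger_constant H p"
  have c0: "0 \<le> c" unfolding c_def by (rule cheeger_constant_nonneg[OF card2])
  have "N \<ge> 2" using card2 by (simp add: N_def)
  obtain v where v: "v \<in> verts H" using card2 by fastforce
  have "finite (unit_ball H v)" using fin by (simp add: unit_ball_def)
  then have "card (unit_ball H v) \<ge> 1"
    using self_in_unit_ball[OF assms(2) v] by (metis card_0_eq empty_iff less_one linorder_not_less)
  then have "b \<ge> 1" using ball[OF v] by linarith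
  have "N * (N / 2 * s powr p) = (\<Sum>g\<in>verts H. N / 2 * s powr p)"
    by (simp add: N_def)
  also have "\<dots> \<le> (\<Sum>g\<in>verts H. \<Sum>h\<in>verts H. Lp_norm M p (\<lambda>x. F g x - F h x) powr p)"
  proof (rule sum_mono)
    fix g assume g: "g \<in> verts H"
    let ?far = "{h \<in> verts H. s \<le> Lp_norm M p (\<lambda>x. F g x - F h x)}"
    have "N / 2 * s powr p \<le> real (card ?far) * s powr p"
      using spread[OF g] by (intro mult_right_mono) (auto simp: N_def)
    also have "\<dots> = (\<Sum>h\<in>?far. s powr p)" by simp
    also have "\<dots> \<le> (\<Sum>h\<in>?far. Lp_norm M p (\<lambda>x. F g x - F h x) powr p)"
      using assms by (intro sum_mono powr_mono2) auto
    also have "\<dots> \<le> (\<Sum>h\<in>verts H. Lp_norm M p (\<lambda>x. F g x - F h x) powr p)"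
      using fin by (intro sum_mono2) auto
    finally show "N / 2 * s powr p \<le> (\<Sum>h\<in>verts H. Lp_norm M p (\<lambda>x. F g x - F h x) powr p)" .
  qed
  finally have "c powr p * (N * (N / 2 * s powr p)) \<le> c powr p *
      (\<Sum>g\<in>verts H. \<Sum>h\<in>verts H. Lp_norm M p (\<lambda>x. F g x - F h x) powr p)"
    by (rule mult_left_mono) simp
  also have "\<dots> \<le> 4 * 4 powr p * N *
        (\<Sum>g\<in>verts H. \<Sum>h\<in>unit_ball H g. Lp_norm M p (\<lambda>x. F h x - F g x) powr p)"
    unfolding c_def N_def using assms by (intro poincare_inequality_Lp_map) auto
  also have "\<dots> \<le> 4 * 4 powr p * N * (\<Sum>g\<in>verts H. b)"
  proof (intro mult_left_mono sum_mono)
    fix g assume g: "g \<in> verts H"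
    have "(\<Sum>h\<in>unit_ball H g. Lp_norm M p (\<lambda>x. F h x - F g x) powr p)
        \<le> (\<Sum>h\<in>unit_ball H g. 1)"
      using assms g by (intro sum_mono powr_le1) (auto simp: Lp_norm_nonneg)
    also have "\<dots> \<le> b" using ball[OF g] by simp
    finally show "(\<Sum>h\<in>unit_ball H g. Lp_norm M p (\<lambda>x. F h x - F g x) powr p) \<le> b" .
  qed (use \<open>N \<ge> 2\<close> in auto)
  also have "\<dots> = N * N * (4 * 4 powr p * b)" by (simp add: N_def)
  finally have "N * N * (c powr p * s powr p) \<le> N * N * (8 * 4 powr p * b)"
    by (simp add: algebra_simps)
  then have "c powr p * s powr p \<le> 8 * 4 powr p * b"
    using \<open>N \<ge> 2\<close> by simp
  \<comment> \<open>As \<open>1 \<le> p\<close>, the factors \<open>8\<close> and \<open>b\<close>, which are at least \<open>1\<close>, are bounded by their \<open>p\<close>-th powers;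
    this makes the final bound independent of \<open>p\<close>.\<close>
  also have "\<dots> \<le> 8 powr p * 4 powr p * b powr p"
    using assms \<open>b \<ge> 1\<close> powr_mono[of 1 p 8] powr_mono[of 1 p b]
    by (intro mult_mono) auto
  also have "8 powr p * 4 powr p = (32::real) powr p"
    by (simp flip: powr_mult)
  finally have "(c * s) powr p \<le> (32 * b) powr p"
    using c0 \<open>0 \<le> s\<close> \<open>b \<ge> 1\<close> by (simp add: powr_mult)
  then show ?thesis
    using assms(1) \<open>b \<ge> 1\<close> unfolding c_def[symmetric]
    by (smt (verit) powr_less_mono2)
qed

section \<open>Compression and the profile\<close>

text \<open>
  For large \<open>a\<close> the quotient \<open>x / (ln x)\<^sup>a\<close> decreases at first, so a constant is unavoidable. With
  \<open>t = ln y / ln x \<ge> 1\<close> the claim reads \<open>t\<^sup>a \<le> const * x\<^bsup>t-1\<^esup>\<close>, where \<open>x \<ge> 2\<close>; so it suffices that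
  \<open>t\<^sup>a\<close> is at most a constant times \<open>2\<^sup>t\<close>.
\<close>

lemma powr_div_ln_quasi_mono:
  fixes a x y :: real
  assumes "0 \<le> a" and "2 \<le> x" and "x \<le> y"
  shows "x / ln x powr a \<le> 2 * ((a + 1) / ln 2) powr a * (y / ln y powr a)"
proof -
  define t where "t = ln y / ln x"
  \<comment> \<open>Scaled so that \<open>ln z \<le> z\<close> gives \<open>z\<^sup>a \<le> 2\<^sup>t\<close>; the denominator is \<open>a + 1\<close> because \<open>a\<close> may vanish.\<close>
  define z where "z = ln 2 * t / (a + 1)"
  have l: "0 < ln (2::real)" "ln 2 \<le> ln x" "ln x \<le> ln y" "0 < ln x" using assms by auto
  have t: "1 \<le> t" using l by (simp add: t_def)
  have z: "0 < z" using t assms by (simp add: z_def)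
  have "z powr a = exp (a * ln z)" using z by (simp add: powr_def)
  also have "\<dots> \<le> exp (a * z)"
    using z assms ln_less_self[OF z] by (simp add: mult_left_mono less_imp_le)
  also have "a * z \<le> ln 2 * t"
    using assms t by (simp add: z_def field_simps)
  also have "ln 2 * t = ln 2 + ln 2 * (t - 1)" by (simp add: algebra_simps)
  also have "\<dots> \<le> ln 2 + ln x * (t - 1)" using l t by (simp add: mult_right_mono)
  also have "\<dots> = ln 2 + (ln y - ln x)" using l by (simp add: t_def field_simps)
  also have "exp \<dots> = 2 * (y / x)" using assms by (simp add: exp_add exp_diff)
  finally have zb: "z powr a \<le> 2 * (y / x)" by simp
  have "(ln y / ln x) powr a = ((a + 1) / ln 2 * z) powr a"
    using assms by (simp add: z_def t_def)
  also have "\<dots> = ((a + 1) / ln 2) powr a * z powr a" 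
    by (rule powr_mult)
  also have "\<dots> \<le> ((a + 1) / ln 2) powr a * (2 * (y / x))"
    using zb by (intro mult_left_mono) auto
  finally have "ln y powr a / ln x powr a \<le> ((a + 1) / ln 2) powr a * (2 * (y / x))"
    using l by (simp add: powr_divide)
  then show ?thesis
    using assms l by (simp add: field_simps)
qed

text \<open>
  The radius is \<open>t = ln N / (2 ln (D + 2))\<close>: at most half of the vertices are closer than \<open>t\<close>
  to a given one, while \<open>t\<^sup>\<alpha>\<close> is still comparable to \<open>(ln N)\<^sup>\<alpha>\<close>. Distances are measured in the ambient
  graph, so the subgraph may be of any shape, even disconnected.
\<close>

lemma cheeger_constant_subgraph_le:
  assumes p: "1 \<le> p" and wf: "wf_digraph G" and deg: "bounded_degree G"
    and comp: "has_compression_exponent G M p \<alpha>"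
  shows "\<exists>C\<ge>0. \<forall>H. subgraph H G \<and> finite (verts H) \<and> 2 \<le> card (verts H) \<longrightarrow>
    cheeger_constant H p \<le> C / ln (real (card (verts H))) powr \<alpha>"
proof -
  obtain D where D: "\<And>v. v \<in> verts G \<Longrightarrow> finite (out_arcs G v) \<and> out_degree G v \<le> D"
    using deg by (auto simp: bounded_degree_def)
  define L where "L = ln (real (D + 2))"
  have "L > 0" by (simp add: L_def)
  obtain F c T where \<alpha>: "0 \<le> \<alpha>" and F: "one_Lipschitz_Lp G M p F" and "c > 0"
    and T: "\<And>t. T \<le> t \<Longrightarrow> ereal (c * t powr \<alpha>) \<le> compression_function G M p F t"
    using comp by (auto simp: has_compression_exponent_def eventually_at_top_linorder)
  \<comment> \<open>\<open>b\<close> bounds unit balls, which are contained in open balls of radius \<open>2\<close>.\<close>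
  define b where "b = real (D + 2) powr 2"
  \<comment> \<open>From \<open>R\<close> vertices on, the radius \<open>t\<close> is at least \<open>T\<close> and \<open>sqrt N \<le> N / 2\<close>; below, the crude bound
    is used.\<close>
  define R where "R = max 4 (exp (2 * L * T))"
  define C where "C = max (32 * b / c * (2 * L) powr \<alpha>) (2 * R * ln R powr \<alpha>)"
  have "C \<ge> 0" using \<open>c > 0\<close> by (simp add: C_def R_def b_def le_max_iff_disj)
  moreover have "cheeger_constant H p \<le> C / ln (real (card (verts H))) powr \<alpha>"
    if H: "subgraph H G" and fin: "finite (verts H)" and card2: "2 \<le> card (verts H)" for H
  proof -
    define N where "N = real (card (verts H))"
    have N2: "N \<ge> 2" using card2 by (simp add: N_def)
    then have lnN: "ln N powr \<alpha> > 0" by simp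
    have wfH: "wf_digraph H" using H by auto
    have sub: "verts H \<subseteq> verts G" by (rule subgraph_imp_subverts[OF H])
    show ?thesis
    proof (cases "N < R")
      case True
      have "cheeger_constant H p \<le> 2 * N"
        unfolding N_def using p wfH fin card2 by (rule cheeger_constant_le_two_card)
      then have "cheeger_constant H p * ln N powr \<alpha> \<le> 2 * N * ln N powr \<alpha>"
        using lnN by simp
      also have "\<dots> \<le> 2 * R * ln R powr \<alpha>"
        using True N2 \<alpha> by (intro mult_mono powr_mono2) auto
      also have "\<dots> \<le> C" by (simp add: C_def)
      finally show ?thesis using lnN by (simp add: N_def field_simps)
    next
      case False
      define t where "t = ln N / (2 * L)"
      have "t > 0" using N2 \<open>L > 0\<close> by (simp add: t_def)
      have "exp (2 * L * T) \<le> N" using False by (simp add: R_def)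
      then have "2 * L * T \<le> ln N" using N2 by (simp add: ln_ge_iff)
      then have "T \<le> t" using \<open>L > 0\<close> by (simp add: t_def field_simps)
      define s where "s = c * t powr \<alpha>"
      have "s > 0" using \<open>c > 0\<close> \<open>t > 0\<close> by (simp add: s_def)
      have "real (D + 2) powr t = exp (ln N / 2)"
        using \<open>L > 0\<close> by (simp add: powr_def t_def L_def)
      also have "\<dots> = sqrt N"
        using N2 by (simp add: ln_sqrt[symmetric])
      also have "\<dots> \<le> N / 2"
      proof (rule real_le_lsqrt)
        have "4 * N \<le> N * N" using False by (intro mult_right_mono) (auto simp: R_def)
        then show "N \<le> (N / 2)\<^sup>2" by (simp add: power2_eq_square)
      qed (use N2 in auto)
      finally have small: "real (D + 2) powr t \<le> N / 2" .
      have "cheeger_constant H p * s \<le> 32 * b"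
      proof (rule cheeger_constant_times_spread_le[OF p wfH fin card2])
        show "F g \<in> Lp_space M p" if "g \<in> verts H" for g
          using that sub F by (auto simp: one_Lipschitz_Lp_def)
        show "real (card (unit_ball H g)) \<le> b" if "g \<in> verts H" for g
        proof -
          have "unit_ball H g \<subseteq> {v. graph_dist G g v < ereal 2}"
            using unit_ball_subgraph[OF H, of g]
            by (auto simp: unit_ball_def intro: le_less_trans)
          moreover have "finite {v. graph_dist G g v < ereal 2}"
            "real (card {v. graph_dist G g v < ereal 2}) \<le> b"
            using card_graph_dist_less_le[OF wf D, of g 2] that sub by (auto simp: b_def)
          ultimately show ?thesis by (meson card_mono of_nat_mono order_trans)
        qed
        show "Lp_norm M p (\<lambda>x. F h x - F g x) \<le> 1" if "g \<in> verts H" "h \<in> unit_ball H g" for g h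
        proof -
          have "h \<in> unit_ball G g" using unit_ball_subgraph[OF H] that by auto
          then have "h \<in> verts G" "graph_dist G g h \<le> 1" by (auto simp: unit_ball_def)
          moreover have "ereal (Lp_norm M p (\<lambda>x. F g x - F h x)) \<le> graph_dist G g h"
            using F that sub \<open>h \<in> verts G\<close> by (auto simp: one_Lipschitz_Lp_def)
          ultimately have "ereal (Lp_norm M p (\<lambda>x. F g x - F h x)) \<le> 1" by (metis order_trans)
          then show ?thesis by (simp add: Lp_norm_def abs_minus_commute)
        qed
        show "0 \<le> s" using \<open>s > 0\<close> by simp
        show "real (card (verts H)) / 2
            \<le> real (card {h \<in> verts H. s \<le> Lp_norm M p (\<lambda>x. F g x - F h x)})"
          if g: "g \<in> verts H" for g
        proof -
          let ?near = "{v. graph_dist G g v < ereal t}"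
          let ?far = "{h \<in> verts H. s \<le> Lp_norm M p (\<lambda>x. F g x - F h x)}"
          have near: "finite ?near" "real (card ?near) \<le> N / 2"
            using card_graph_dist_less_le[OF wf D, of g t] g sub \<open>t > 0\<close> small by auto
          have "h \<in> ?far" if h: "h \<in> verts H" "h \<notin> ?near" for h
          proof -
            have "ereal s \<le> compression_function G M p F t"
              unfolding s_def using T \<open>T \<le> t\<close> by blast
            also have "\<dots> \<le> ereal (Lp_norm M p (\<lambda>x. F g x - F h x))"
              unfolding compression_function_def using g h sub
              by (intro Inf_lower) (auto simp: not_less)
            finally show ?thesis using h by simp
          qed
          then have "verts H \<subseteq> ?near \<union> ?far" by auto
          then have "card (verts H) \<le> card ?near + card ?far"
            using near(1) fin by (intro order_trans[OF card_mono card_Un_le]) auto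
          then show ?thesis using near(2) by (simp add: N_def)
        qed
      qed
      then have "cheeger_constant H p \<le> 32 * b / s"
        using \<open>s > 0\<close> by (simp add: field_simps)
      also have "\<dots> = 32 * b / c * (2 * L) powr \<alpha> / ln N powr \<alpha>"
        using \<open>L > 0\<close> N2 by (simp add: s_def t_def powr_divide)
      also have "\<dots> \<le> C / ln N powr \<alpha>"
        using lnN by (intro divide_right_mono) (auto simp: C_def)
      finally show ?thesis by (simp add: N_def)
    qed
  qed
  ultimately show ?thesis by blast
qed

theorem corollary1p4:
  fixes G :: "('a, 'e) pre_digraph" and M :: "'m measure" and p \<alpha> :: real
  assumes "1 \<le> p"
    and "unoriented_graph G"
    and "bounded_degree G"
    and "has_compression_exponent G M p \<alpha>"
  shows "\<exists>K::real. \<forall>n::nat. 2 \<le> n \<longrightarrow>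
           poincare_profile G p n \<le> ereal (K * (real n / ln (real n) powr \<alpha>))"
proof -
  have wf: "wf_digraph G"
    using assms(2) by (simp add: unoriented_graph_def loopfree_digraph_def)
  have \<alpha>: "0 \<le> \<alpha>" using assms(4) by (simp add: has_compression_exponent_def)
  obtain C where "C \<ge> 0" and C: "\<And>H. subgraph H G \<Longrightarrow> finite (verts H) \<Longrightarrow> 2 \<le> card (verts H) \<Longrightarrow>
      cheeger_constant H p \<le> C / ln (real (card (verts H))) powr \<alpha>"
    using cheeger_constant_subgraph_le[OF assms(1) wf assms(3,4)] by blast
  define K where "K = C * (2 * ((\<alpha> + 1) / ln 2) powr \<alpha>)"
  have "K \<ge> 0" using \<open>C \<ge> 0\<close> by (simp add: K_def)
  have "poincare_profile G p n \<le> ereal (K * (real n / ln (real n) powr \<alpha>))" if "2 \<le> n" for n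
    unfolding poincare_profile_def
  proof (rule Sup_least, clarify)
    fix H assume H: "subgraph H G" "pseudo_graph H" "verts H \<noteq> {}" "card (verts H) \<le> n"
    interpret H: pseudo_graph H by fact
    have fin: "finite (verts H)" by simp
    then have "card (verts H) \<noteq> 0" using H(3) by simp
    then consider "card (verts H) = 1" | "2 \<le> card (verts H)" by linarith
    then have "real (card (verts H)) * cheeger_constant H p \<le> K * (real n / ln (real n) powr \<alpha>)"
    proof cases
      case 1
      then show ?thesis using \<open>K \<ge> 0\<close> by (simp add: cheeger_constant_def)
    next
      case 2
      define N where "N = real (card (verts H))"
      have "N * cheeger_constant H p \<le> N * (C / ln N powr \<alpha>)"
        unfolding N_def using C[OF H(1) fin 2] by (intro mult_left_mono) auto
      also have "\<dots> = C * (N / ln N powr \<alpha>)" by simp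
      also have "\<dots> \<le> C * (2 * ((\<alpha> + 1) / ln 2) powr \<alpha> * (real n / ln (real n) powr \<alpha>))"
        using \<open>C \<ge> 0\<close> \<alpha> 2 H(4) by (intro mult_left_mono powr_div_ln_quasi_mono) (auto simp: N_def)
      finally show ?thesis by (simp add: K_def N_def mult.assoc)
    qed
    then show "ereal (real (card (verts H)) * cheeger_constant H p)
        \<le> ereal (K * (real n / ln (real n) powr \<alpha>))" by simp
  qed
  then show ?thesis by blast
qed

end
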